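(* Let $k\ge 2$. For all $\ell\ge 2$, the generating function $$B_{\ell,k}(x,t)=\sum_{w\in[\ell]^*}x^{(1,k)\text{-rec}(w)}t^{|w|}$$ satisfies $$B_{\ell,k}(x,t) = 1 + \ell t - \vec{1}_{\ell,k}\, \mathbb{B}_{\ell,k}^{-1}\, (\vec{I}_{\ell,k})^T ,$$ where the vectors $\vec{1}_{\ell,k},\vec{I}_{\ell,k}$ and the $\ell^2\times\ell^2$ matrix $\mathbb{B}_{\ell,k}$ are as follows, with coordinates indexed by the pairs $(i,j)\in[\ell]^2$ in lexicographic order. $\vec{1}_{\ell,k}$ is the row vector of length $\ell^2$ consisting of all $1$s; $\vec{I}_{\ell,k}$ is the row vector whose $(i,j)$ entry is $x^2t^2$ if $|i-j|\le k$ and $t^2$ if $|i-j|>k$; and $\mathbb{B}_{\ell,k}=C-\mathrm{Id}$, where $\mathrm{Id}$ is the identity matrix and $C$ is the matrix whose entry in row $(i,j)$ and column $(p,q)$ is $0$ if $p\ne j$, and, if $p=j$, is $$\begin{cases} t & \text{if } |i-j|>k,\\ xt & \text{if } |i-j|\le k \text{ and } |j-q|\le k,\\ x^2t & \text{if } |i-j|\le k\text{ and } |j-q|>k.\end{cases}$$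
   Context: $[\ell]=\{1,\ldots,\ell\}$, $[\ell]^*$ is the set of all finite words over $[\ell]$ (including the empty word), and $|w|$ is the length of $w$. For a word $w=w_1\cdots w_n$, the letter $w_i$ matches the $(1,k)$-rectangle pattern in $w$ if $|w_i-w_{i+1}|\le k$ (with $i+1\le n$) or $|w_{i-1}-w_i|\le k$ (with $i-1\ge 1$); $(1,k)\text{-rec}(w)$ is the number of indices $i$ such that $w_i$ matches the $(1,k)$-rectangle pattern in $w$. The identity is one of formal power series in $t$ with coefficients in $\mathbb{Z}[x]$ (at $t=0$ the matrix $\mathbb{B}_{\ell,k}$ equals minus the identity, so it is invertible). *)

theory Defs
  imports
    "Jordan_Normal_Form.Matrix"
    "HOL-Computational_Algebra.Polynomial"
    "HOL-Computational_Algebra.Formal_Power_Series"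
begin

definition words :: "nat \<Rightarrow> nat list set" where
  "words l = lists {1..l}"

definition close :: "nat \<Rightarrow> nat \<Rightarrow> nat \<Rightarrow> bool" where
  "close k a b \<longleftrightarrow> \<bar>int a - int b\<bar> \<le> int k"

text \<open>Positions in a word are counted from 0, as for list indexing.\<close>

definition matches_rect :: "nat \<Rightarrow> nat list \<Rightarrow> nat \<Rightarrow> bool" where
  "matches_rect k w i \<longleftrightarrow>
     (i + 1 < length w \<and> close k (w ! i) (w ! (i + 1))) \<or>
     (1 \<le> i \<and> close k (w ! (i - 1)) (w ! i))"

definition rect :: "nat \<Rightarrow> nat list \<Rightarrow> nat" where
  "rect k w = card {i. i < length w \<and> matches_rect k w i}"

text \<open>
  Generating functions are power series in \<open>t\<close> over the polynomial ring
  \<open>\<int>[x]\<close>. The formal sum over all words is given by its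
  coefficients: that of \<open>t ^ n\<close> is the finite sum of
  \<open>x ^ rect k w\<close> over the words \<open>w\<close> of length \<open>n\<close>.
\<close>

abbreviation X :: "int poly fps" where
  "X \<equiv> fps_const [:0, 1:]"

abbreviation T :: "int poly fps" where
  "T \<equiv> fps_X"

definition rect_gf :: "nat \<Rightarrow> nat \<Rightarrow> int poly fps" where
  "rect_gf l k = Abs_fps (\<lambda>n. \<Sum>w \<in> {w \<in> words l. length w = n}. [:0, 1:] ^ rect k w)"

text \<open>
  Coordinates \<open>r < l * l\<close> enumerate the pairs in \<open>{1..l} \<times> {1..l}\<close>
  lexicographically; \<open>pair_at l r\<close> is the pair at (0-based) place \<open>r\<close>.
\<close>

definition pair_at :: "nat \<Rightarrow> nat \<Rightarrow> nat \<times> nat" where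
  "pair_at l r = (r div l + 1, r mod l + 1)"

definition ones_vec :: "nat \<Rightarrow> int poly fps vec" where
  "ones_vec l = vec (l\<^sup>2) (\<lambda>_. 1)"

definition I_vec :: "nat \<Rightarrow> nat \<Rightarrow> int poly fps vec" where
  "I_vec l k = vec (l\<^sup>2) (\<lambda>r. case pair_at l r of (i, j) \<Rightarrow>
     if close k i j then X\<^sup>2 * T\<^sup>2 else T\<^sup>2)"

definition C_mat :: "nat \<Rightarrow> nat \<Rightarrow> int poly fps mat" where
  "C_mat l k = mat (l\<^sup>2) (l\<^sup>2) (\<lambda>(r, c).
     case pair_at l r of (i, j) \<Rightarrow> case pair_at l c of (p, q) \<Rightarrow>
       if p \<noteq> j then 0
       else if \<not> close k i j then T
       else if close k j q then X * T
       else X\<^sup>2 * T)"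

definition B_mat :: "nat \<Rightarrow> nat \<Rightarrow> int poly fps mat" where
  "B_mat l k = C_mat l k - 1\<^sub>m (l\<^sup>2)"

text \<open>
  The two-sided inverse over a ring; for a square matrix it is unique if it
  exists (the two equations also fix the dimensions of \<open>M\<close>), and
  otherwise the value is unspecified.
\<close>

definition mat_inv :: "'a::comm_ring_1 mat \<Rightarrow> 'a mat" where
  "mat_inv A = (THE M. inverts_mat A M \<and> inverts_mat M A)"

end

(* Let V (i, j) be the generating function of the words beginning with the letters i, j. Prepending
   a letter i to a word beginning with j, q changes the matching status of its first letter only;
   the multiplier is the entry of C at ((i, j), (j, q)). Hence V = I + C V, that is B V = - I, and the
   words of length at least 2 contribute the sum of the entries of V = - B^(-1) I. *)

theory Submission
  imports Defs "Jordan_Normal_Form.Determinant"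
begin

section \<open>Inverses of matrices\<close>

text \<open>A power series over a commutative ring is a unit as soon as its constant coefficient is
  one. Here \<open>u\<close> inverts the constant coefficient of \<open>det A\<close>, so the
  adjugate divided by the determinant is a two-sided inverse.\<close>

lemma fps_mat_inverse_exists:
  fixes A :: "'a::comm_ring_1 fps mat"
  assumes A: "A \<in> carrier_mat n n"
    and unit: "det (map_mat (\<lambda>f. fps_nth f 0) A) * u = 1"
  obtains M where "M \<in> carrier_mat n n" "A * M = 1\<^sub>m n" "M * A = 1\<^sub>m n"
proof -
  \<comment> \<open>As a ring homomorphism, taking constant coefficients commutes with
    \<open>det\<close>.\<close>
  interpret const_coeff: comm_ring_hom "\<lambda>f::'a fps. fps_nth f 0"
    by unfold_locales (auto simp: fps_mult_nth_0)
  have "fps_nth (det A) 0 * u = 1"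
    using unit by simp
  then have inv: "det A * fps_right_inverse (det A) u = 1"
    by (rule fps_right_inverse)
  define d where "d = fps_right_inverse (det A) u"
  have adj: "adj_mat A \<in> carrier_mat n n"
    "A * adj_mat A = det A \<cdot>\<^sub>m 1\<^sub>m n" "adj_mat A * A = det A \<cdot>\<^sub>m 1\<^sub>m n"
    using adj_mat[OF A] by auto
  have one: "d \<cdot>\<^sub>m (det A \<cdot>\<^sub>m 1\<^sub>m n) = 1\<^sub>m n"
    using inv by (auto simp: d_def mult.commute)
  show ?thesis
  proof
    show "d \<cdot>\<^sub>m adj_mat A \<in> carrier_mat n n"
      using adj by simp
    show "A * (d \<cdot>\<^sub>m adj_mat A) = 1\<^sub>m n"
      using mult_smult_distrib[OF A adj(1)] adj one by simp
    show "(d \<cdot>\<^sub>m adj_mat A) * A = 1\<^sub>m n"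
      using mult_smult_assoc_mat[OF adj(1) A] adj one by simp
  qed
qed

lemma mat_inv_eqI:
  fixes A :: "'a::comm_ring_1 mat"
  assumes A: "A \<in> carrier_mat n n" and M: "M \<in> carrier_mat n n"
    and AM: "A * M = 1\<^sub>m n" and MA: "M * A = 1\<^sub>m n"
  shows "mat_inv A = M"
  unfolding mat_inv_def
proof (rule the_equality)
  show "inverts_mat A M \<and> inverts_mat M A"
    using assms by (auto simp: inverts_mat_def)
next
  fix N assume N: "inverts_mat A N \<and> inverts_mat N A"
  then have "A * N = 1\<^sub>m n" and NA: "N * A = 1\<^sub>m (dim_row N)"
    using A by (auto simp: inverts_mat_def)
  \<comment> \<open>The shape of \<open>N\<close> is not given; comparing the numbers of columns in
    both equations yields it.\<close>
  then have "dim_col N = n"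
    by (metis index_mult_mat(3) index_one_mat(3))
  moreover have "dim_row N = n"
    using NA A by (metis carrier_matD(2) index_mult_mat(3) index_one_mat(3))
  ultimately have Nc: "N \<in> carrier_mat n n"
    by auto
  have "N = (M * A) * N"
    using MA Nc by simp
  also have "\<dots> = M * (A * N)"
    using M A Nc by (rule assoc_mult_mat)
  also have "\<dots> = M"
    using \<open>A * N = 1\<^sub>m n\<close> M by simp
  finally show "N = M" .
qed

lemma B_mat_carrier: "B_mat l k \<in> carrier_mat (l\<^sup>2) (l\<^sup>2)"
  unfolding B_mat_def by (rule minus_carrier_mat) simp

text \<open>Every entry of \<open>C_mat\<close> is a multiple of \<open>T\<close>, so at t = 0 the
  matrix is minus the identity, whose determinant is a power of -1 and hence its own
  inverse.\<close>

lemma B_mat_inverse: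
  obtains M where "M \<in> carrier_mat (l\<^sup>2) (l\<^sup>2)"
    "B_mat l k * M = 1\<^sub>m (l\<^sup>2)" "M * B_mat l k = 1\<^sub>m (l\<^sup>2)"
proof -
  have "map_mat (\<lambda>f. fps_nth f 0) (B_mat l k) = (- 1) \<cdot>\<^sub>m 1\<^sub>m (l\<^sup>2)"
    by (rule eq_matI)
      (auto simp: B_mat_def C_mat_def fps_mult_nth_0 split: prod.splits)
  then have "det (map_mat (\<lambda>f. fps_nth f 0) (B_mat l k)) = (- 1) ^ (l\<^sup>2)"
    by (simp only: det_smult det_one) simp
  then have "det (map_mat (\<lambda>f. fps_nth f 0) (B_mat l k)) * (- 1) ^ (l\<^sup>2) = 1"
    by (simp flip: power_mult_distrib)
  then show ?thesis
    using fps_mat_inverse_exists[OF B_mat_carrier] that by blast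
qed

section \<open>Words\<close>

definition words_of_length :: "nat \<Rightarrow> nat \<Rightarrow> nat list set" where
  "words_of_length l n = {w \<in> words l. length w = n}"

lemma sum_words_Suc:
  "(\<Sum>w\<in>words_of_length l (Suc n). f w) = (\<Sum>a=1..l. \<Sum>w\<in>words_of_length l n. f (a # w))"
proof -
  have "words_of_length l (Suc n) = (\<lambda>(a, w). a # w) ` ({1..l} \<times> words_of_length l n)"
    by (auto simp: words_of_length_def words_def length_Suc_conv image_iff)
  moreover have "inj_on (\<lambda>(a, w). a # w) ({1..l} \<times> words_of_length l n)"
    by (auto simp: inj_on_def)
  ultimately show ?thesis
    by (simp add: sum.reindex sum.cartesian_product case_prod_unfold)
qed

lemma words_of_length_0: "words_of_length l 0 = {[]}"
  by (auto simp: words_of_length_def words_def)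

section \<open>Matching positions after prepending a letter\<close>

lemma card_less_Suc_shift:
  "card {i. i < Suc n \<and> P i} = (if P 0 then 1 else 0) + card {i. i < n \<and> P (Suc i)}"
proof -
  have "{i. i < Suc n \<and> P i} = (if P 0 then {0} else {}) \<union> Suc ` {i. i < n \<and> P (Suc i)}"
    by (auto simp: image_iff less_Suc_eq_0_disj)
  then show ?thesis
    by (auto simp: card_Un_disjoint card_image)
qed

lemma rect_singleton: "rect k [a] = 0"
  by (simp add: rect_def matches_rect_def)

lemma rect_pair: "rect k [i, j] = (if close k i j then 2 else 0)"
  by (simp add: rect_def matches_rect_def card_less_Suc_shift del: less_Suc0)

text \<open>If \<open>i\<close> and \<open>j\<close> are close, the new letter \<open>i\<close>
  matches, and \<open>j\<close> becomes a new match exactly when it did not already match through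
  \<open>q\<close>. All later letters keep their neighbours.\<close>

lemma rect_Cons:
  "rect k (i # j # q # u) =
     (if close k i j then if close k j q then 1 else 2 else 0) + rect k (j # q # u)"
  by (simp add: rect_def matches_rect_def card_less_Suc_shift)

section \<open>The linear system\<close>

definition prefix_gf :: "nat \<Rightarrow> nat \<Rightarrow> nat \<Rightarrow> nat \<Rightarrow> int poly fps" where
  "prefix_gf l k i j = T\<^sup>2 *
     Abs_fps (\<lambda>n. \<Sum>w\<in>words_of_length l n. [:0, 1:] ^ rect k (i # j # w))"

text \<open>The factor gained by prepending \<open>i\<close> to a word that begins with
  \<open>j\<close>, \<open>q\<close>; multiplied by \<open>T\<close>, it is the entry of
  \<open>C_mat\<close> in row (i, j) and column (j, q).\<close>

definition step :: "nat \<Rightarrow> nat \<Rightarrow> nat \<Rightarrow> nat \<Rightarrow> int poly" where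
  "step k i j q = [:0, 1:] ^ (if close k i j then if close k j q then 1 else 2 else 0)"

text \<open>A word beginning with \<open>i\<close>, \<open>j\<close> either ends there or has a
  third letter \<open>q\<close>; in the second case, deleting \<open>i\<close> leaves a word counted
  by \<open>prefix_gf l k j q\<close>.\<close>

lemma prefix_gf_rec:
  "prefix_gf l k i j = (if close k i j then X\<^sup>2 * T\<^sup>2 else T\<^sup>2)
     + (\<Sum>q=1..l. T * fps_const (step k i j q) * prefix_gf l k j q)"
proof -
  let ?F = "\<lambda>i j. Abs_fps (\<lambda>n. \<Sum>w\<in>words_of_length l n. [:0, 1:] ^ rect k (i # j # w) :: int poly)"
  \<comment> \<open>With the factor \<open>T\<^sup>2\<close> removed, the constant coefficient
    belongs to the word \<open>[i, j]\<close> alone, and each higher one splits by the third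
    letter.\<close>
  have "?F i j = fps_const ([:0, 1:] ^ rect k [i, j])
      + T * (\<Sum>q=1..l. fps_const (step k i j q) * ?F j q)"
  proof (rule fps_ext)
    fix n
    show "fps_nth (?F i j) n = fps_nth (fps_const ([:0, 1:] ^ rect k [i, j])
      + T * (\<Sum>q=1..l. fps_const (step k i j q) * ?F j q)) n"
    proof (cases n)
      case 0
      then show ?thesis
        by (simp add: words_of_length_0)
    next
      case (Suc m)
      then show ?thesis
        by (simp add: fps_sum_nth sum_words_Suc rect_Cons step_def power_add sum_distrib_left)
    qed
  qed
  then show ?thesis
    by (simp add: prefix_gf_def rect_pair sum_distrib_left fps_const_power algebra_simps)
qed

lemma rect_gf_conv_words_of_length:
  "rect_gf l k = Abs_fps (\<lambda>n. \<Sum>w\<in>words_of_length l n. [:0, 1:] ^ rect k w)"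
  by (simp add: rect_gf_def words_of_length_def)

lemma rect_gf_conv_prefix_gf:
  "rect_gf l k = 1 + of_nat l * T + (\<Sum>i=1..l. \<Sum>j=1..l. prefix_gf l k i j)"
proof (rule fps_ext)
  fix n
  \<comment> \<open>The factor \<open>T\<^sup>2\<close> makes every \<open>prefix_gf\<close> vanish
    in degrees 0 and 1, where the empty word and the \<open>l\<close> one-letter words, all without
    matches, give 1 and \<open>of_nat l * T\<close>.\<close>
  consider "n = 0" | "n = 1" | m where "n = Suc (Suc m)"
    by (metis One_nat_def not0_implies_Suc)
  then show "fps_nth (rect_gf l k) n =
      fps_nth (1 + of_nat l * T + (\<Sum>i=1..l. \<Sum>j=1..l. prefix_gf l k i j)) n"
  proof cases
    case 1
    then show ?thesis
      by (simp add: rect_gf_conv_words_of_length prefix_gf_def words_of_length_0 fps_sum_nth fps_X_power_mult_nth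
          fps_mult_nth_0 rect_def)
  next
    case 2
    then show ?thesis
      by (simp add: rect_gf_conv_words_of_length prefix_gf_def words_of_length_0 fps_sum_nth fps_X_power_mult_nth
          sum_words_Suc rect_singleton)
  next
    case 3
    then show ?thesis
      by (simp add: rect_gf_conv_words_of_length prefix_gf_def fps_sum_nth fps_X_power_mult_nth sum_words_Suc)
  qed
qed

section \<open>Pairs as coordinates of vectors and matrices\<close>

lemma sum_pair_at:
  "(\<Sum>r = 0..<l\<^sup>2. case pair_at l r of (i, j) \<Rightarrow> f i j) = (\<Sum>i=1..l. \<Sum>j=1..l. f i j)"
proof -
  have "(\<Sum>r = 0..<l\<^sup>2. case pair_at l r of (i, j) \<Rightarrow> f i j)
      = (\<Sum>(i, j)\<in>{1..l} \<times> {1..l}. f i j)"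
  \<comment> \<open>Division with remainder by \<open>l\<close> makes \<open>pair_at l\<close> a
    bijection; the witness \<open>i\<close> is its inverse.\<close>
  proof (rule sum.reindex_bij_witness
      [where j = "pair_at l" and i = "\<lambda>(i, j). (i - 1) * l + (j - 1)"], goal_cases)
    case (2 r)
    then have "0 < l"
      by (cases l) auto
    then show ?case
      using 2 by (auto simp: pair_at_def power2_eq_square less_mult_imp_div_less Suc_le_eq)
  next
    case (3 p)
    \<comment> \<open>Writing both coordinates as successors removes the truncated
      subtractions.\<close>
    then obtain i j where p: "p = (Suc i, Suc j)" "i < l" "j < l"
      by (cases p; cases "fst p"; cases "snd p") auto
    then show ?case
      by (simp add: pair_at_def)
  next
    case (4 p)
    then obtain i j where p: "p = (Suc i, Suc j)" "i < l" "j < l"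
      by (cases p; cases "fst p"; cases "snd p") auto
    then have "i * l + j < Suc i * l"
      by simp
    also have "\<dots> \<le> l\<^sup>2"
      using p by (simp only: power2_eq_square mult_le_mono1 Suc_le_eq)
    finally show ?case
      using p by simp
  qed (auto simp: pair_at_def)
  then show ?thesis
    by (simp add: sum.cartesian_product)
qed

definition prefix_vec :: "nat \<Rightarrow> nat \<Rightarrow> int poly fps vec" where
  "prefix_vec l k = vec (l\<^sup>2) (\<lambda>r. case pair_at l r of (i, j) \<Rightarrow> prefix_gf l k i j)"

lemma prefix_vec_carrier: "prefix_vec l k \<in> carrier_vec (l\<^sup>2)"
  by (simp add: prefix_vec_def)

text \<open>The three nonzero cases of \<open>C_mat\<close> are \<open>T\<close> times the powers 0,
  1 and 2 of x, the values of \<open>step\<close>.\<close>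

lemma C_mat_entry:
  assumes "r < l\<^sup>2" "c < l\<^sup>2" "pair_at l r = (i, j)"
  shows "C_mat l k $$ (r, c) =
    (case pair_at l c of (p, q) \<Rightarrow> if p = j then T * fps_const (step k i j q) else 0)"
  using assms by (auto simp: C_mat_def step_def fps_const_power mult.commute split: prod.splits)

lemma C_mat_mult_prefix_vec:
  assumes r: "r < l\<^sup>2" and ij: "pair_at l r = (i, j)"
  shows "(C_mat l k *\<^sub>v prefix_vec l k) $ r
    = (\<Sum>q=1..l. T * fps_const (step k i j q) * prefix_gf l k j q)"
proof -
  \<comment> \<open>This ensures that the block of columns with p = j occurs, so the sum over all
    columns collapses to the sum over \<open>q\<close>.\<close>
  have j: "j \<in> {1..l}"
    using r ij by (cases l) (auto simp: pair_at_def Suc_le_eq)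
  have "(C_mat l k *\<^sub>v prefix_vec l k) $ r
      = (\<Sum>c = 0..<l\<^sup>2. C_mat l k $$ (r, c) * prefix_vec l k $ c)"
    using r by (simp add: scalar_prod_def prefix_vec_def C_mat_def)
  also have "\<dots> = (\<Sum>c = 0..<l\<^sup>2. case pair_at l c of (p, q) \<Rightarrow>
      if p = j then T * fps_const (step k i j q) * prefix_gf l k p q else 0)"
    using r ij by (intro sum.cong) (auto simp: C_mat_entry prefix_vec_def split: prod.splits)
  also have "\<dots> = (\<Sum>p=1..l. \<Sum>q=1..l.
      if p = j then T * fps_const (step k i j q) * prefix_gf l k p q else 0)"
    by (rule sum_pair_at)
  also have "\<dots> = (\<Sum>p=1..l. if p = j then
      (\<Sum>q=1..l. T * fps_const (step k i j q) * prefix_gf l k p q) else 0)"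
    by (intro sum.cong) auto
  also have "\<dots> = (\<Sum>q=1..l. T * fps_const (step k i j q) * prefix_gf l k j q)"
    using j by simp
  finally show ?thesis .
qed

text \<open>This is \<open>prefix_gf_rec\<close> for all pairs at once, with the vector itself moved
  to the left-hand side.\<close>

lemma B_mat_mult_prefix_vec: "B_mat l k *\<^sub>v prefix_vec l k = - I_vec l k"
proof -
  have C: "C_mat l k \<in> carrier_mat (l\<^sup>2) (l\<^sup>2)"
    by (simp add: C_mat_def)
  have "B_mat l k *\<^sub>v prefix_vec l k = C_mat l k *\<^sub>v prefix_vec l k - prefix_vec l k"
    unfolding B_mat_def
    using minus_mult_distrib_mat_vec[OF C one_carrier_mat prefix_vec_carrier] prefix_vec_carrier
    by simp
  also have "\<dots> = - I_vec l k"
  proof (rule eq_vecI)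
    fix r assume "r < dim_vec (- I_vec l k)"
    then have r: "r < l\<^sup>2"
      by (simp add: I_vec_def)
    obtain i j where ij: "pair_at l r = (i, j)"
      by fastforce
    have "(C_mat l k *\<^sub>v prefix_vec l k - prefix_vec l k) $ r
        = (C_mat l k *\<^sub>v prefix_vec l k) $ r - prefix_gf l k i j"
      using r ij by (simp add: prefix_vec_def)
    also have "\<dots> = - (if close k i j then X\<^sup>2 * T\<^sup>2 else T\<^sup>2)"
      using C_mat_mult_prefix_vec[OF r ij] prefix_gf_rec[of l k i j] by simp
    also have "\<dots> = (- I_vec l k) $ r"
      using r ij by (simp add: I_vec_def)
    finally show "(C_mat l k *\<^sub>v prefix_vec l k - prefix_vec l k) $ r = (- I_vec l k) $ r" .
  qed (simp add: prefix_vec_def I_vec_def)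
  finally show ?thesis .
qed

lemma ones_vec_prefix_vec:
  "ones_vec l \<bullet> prefix_vec l k = (\<Sum>i=1..l. \<Sum>j=1..l. prefix_gf l k i j)"
proof -
  have "ones_vec l \<bullet> prefix_vec l k
      = (\<Sum>r = 0..<l\<^sup>2. case pair_at l r of (i, j) \<Rightarrow> prefix_gf l k i j)"
    by (simp add: scalar_prod_def ones_vec_def prefix_vec_def)
  then show ?thesis
    by (simp only: sum_pair_at)
qed

theorem theorem7:
  fixes k l :: nat
  assumes "k \<ge> 2" and "l \<ge> 2"
  shows "invertible_mat (B_mat l k) \<and>
    rect_gf l k = 1 + of_nat l * T - ones_vec l \<bullet> (mat_inv (B_mat l k) *\<^sub>v I_vec l k)"
proof -
  note B = B_mat_carrier[of l k]
  have I: "I_vec l k \<in> carrier_vec (l\<^sup>2)"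
    by (simp add: I_vec_def)
  obtain M where M: "M \<in> carrier_mat (l\<^sup>2) (l\<^sup>2)"
    and BM: "B_mat l k * M = 1\<^sub>m (l\<^sup>2)" and MB: "M * B_mat l k = 1\<^sub>m (l\<^sup>2)"
    by (rule B_mat_inverse)
  have inv: "mat_inv (B_mat l k) = M"
    using B M BM MB by (rule mat_inv_eqI)
  have "invertible_mat (B_mat l k)"
    using B M BM MB by (auto simp: invertible_mat_def inverts_mat_def)
  \<comment> \<open>Multiplying the linear system by \<open>M\<close> from the left solves it for
    \<open>prefix_vec\<close>; its minus sign cancels the one in the claimed formula.\<close>
  moreover have "prefix_vec l k = (M * B_mat l k) *\<^sub>v prefix_vec l k"
    using MB prefix_vec_carrier by simp
  then have "prefix_vec l k = M *\<^sub>v (- I_vec l k)"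
    using M B prefix_vec_carrier[of l k] by (simp add: B_mat_mult_prefix_vec)
  then have "M *\<^sub>v I_vec l k = - prefix_vec l k"
    using M I by (auto simp: uminus_mult_mat_vec)
  then have "ones_vec l \<bullet> (M *\<^sub>v I_vec l k) = - (ones_vec l \<bullet> prefix_vec l k)"
    by (simp add: ones_vec_def prefix_vec_def)
  ultimately show ?thesis
    by (simp add: inv rect_gf_conv_prefix_gf ones_vec_prefix_vec)
qed

end
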